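(* Given $\hat{\mathcal X}$, let $(\bar v,\bar u,\{\bar\epsilon^k\}_{k\in\mathcal K})$ and $(\tilde v,\bar u,\{\tilde\epsilon^k\}_{k\in\mathcal K})$ be two distinct feasible solutions of the mixed-integer system (MIP). Let $\bar{\mathcal C}=\mathrm{cone}(\{a^i\}_{i:\bar v_i=1})$ and $\tilde{\mathcal C}=\mathrm{cone}(\{a^i\}_{i:\tilde v_i=1})$. If $\bar v\ge\tilde v$ (componentwise), then: (i) $\bar{\mathcal C}$ is at least as forward-stable as $\tilde{\mathcal C}$; i.e. for any $\tilde c\in\tilde{\mathcal C}$ there exists $\bar c\in\bar{\mathcal C}$ such that $\max_{x\in\mathcal X^*(\bar c)}\|\hat x^k-x\|_\ell\le\max_{x\in\mathcal X^*(\tilde c)}\|\hat x^k-x\|_\ell$ for all $k\in\mathcal K$. (ii) $\bar{\mathcal C}$ is at least as inverse-stable as $\tilde{\mathcal C}$; i.e. $$\inf_{\mathcal D\in(\mathbb R^n)^K}\{d(\hat{\mathcal X},\mathcal D):\bar{\mathcal C}\cap\mathcal C(\mathcal D)=\emptyset\}\ \ge\ \inf_{\mathcal D\in(\mathbb R^n)^K}\{d(\hat{\mathcal X},\mathcal D):\tilde{\mathcal C}\cap\mathcal C(\mathcal D)=\emptyset\},$$ where $\mathcal C(\mathcal D)$ denotes the set of inverse-feasible cost vectors for the dataset $\mathcal D$ of $K$ points in $\mathbb R^n$.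
   Context: Setting: $A\in\mathbb R^{m\times n}$, $b\in\mathbb R^m$, $\mathcal I=\{1,\dots,m\}$; $a^i\in\mathbb R^n$ is the $i$-th row of $A$ written as a column vector; prime denotes transpose. The forward feasible region $\mathcal X=\{x\in\mathbb R^n: Ax\ge b\}$ is bounded, full-dimensional and free of redundant constraints. Norm parameters $\ell,p\ge1$ (possibly $\infty$) are fixed, and $\|a^i\|_p=1$ for all $i$. For $c\in\mathbb R^n$, $\mathcal X^*(c)=\arg\min_x\{c'x: x\in\mathcal X\}$. The dataset $\hat{\mathcal X}=\{\hat x^1,\dots,\hat x^K\}\subset\mathbb R^n$ is indexed by $\mathcal K=\{1,\dots,K\}$, with no assumption on feasibility or optimality of the points. $\tau\ge0$ and $\theta\in[0,1]$. $\mathrm{cone}(\cdot)$ is the set of conic (nonnegative linear) combinations of the given vectors. $d$ is a distance function between datasets, e.g. $d(\hat{\mathcal X},\tilde{\mathcal X})=\sum_k\|\hat x^k-\tilde x^k\|_\ell$. The infimum of the empty set is $+\infty$. Quantile inverse optimization problem $\mathbf{QIO}(\hat{\mathcal X},\tau,\theta)$: find $c\in\mathbb R^n$, $\{\epsilon^k\}_{k\in\mathcal K}\subset\mathbb R^n$, $y\in\mathbb R^m$, $\mathcal S\subseteq\mathcal K$ such that $A'y=c$, $y\ge0$; $A(\hat x^k-\epsilon^k)\ge b$, $c'(\hat x^k-\epsilon^k)=b'y$ and $\|\epsilon^k\|_\ell\le\tau$ for all $k\in\mathcal S$; $|\mathcal S|\ge\theta K$; and $\|c\|_p=1$. A cost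 vector $c$ is inverse-feasible for $\hat{\mathcal X}$ if it is the $c$-component of such a feasible solution (with $\tau,\theta$ fixed). System (MIP), in $v\in\{0,1\}^m$, $u\in\{0,1\}^K$, $\epsilon^k\in\mathbb R^n$ ($k\in\mathcal K$): $b_i\le {a^i}'(\hat x^k-\epsilon^k)\le b_i+M_1(1-v_i)$ for all $i\in\mathcal I,k\in\mathcal K$; $\|\epsilon^k\|_\ell\le\tau+M_2(1-u_k)$ for all $k\in\mathcal K$; $\sum_{k=1}^K u_k\ge\theta K$. Here $M_1,M_2$ are sufficiently large constants, i.e. $M_1\ge\max_{i\in\mathcal I,x\in\mathcal X}({a^i}'x-b_i)$ and $M_2\ge\max_{k\in\mathcal K,x\in\mathcal X}\|\hat x^k-x\|_\ell$. *)

theory Defs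
  imports "HOL-Analysis.Analysis"
begin

text \<open>
  The index sets are finite types: \<open>'m\<close> for the constraints, \<open>'n\<close> for the coordinates and
  \<open>'k\<close> for the data points, so a dataset of \<open>K = CARD('k)\<close> points is a function
  \<open>'k \<Rightarrow> real ^ 'n\<close>. The order on vectors is componentwise.
\<close>

definition lp_norm :: "ereal \<Rightarrow> real ^ 'n \<Rightarrow> real" where
  "lp_norm p x =
     (if p = \<infinity> then infnorm x
      else (\<Sum>i\<in>UNIV. \<bar>x $ i\<bar> powr real_of_ereal p) powr (1 / real_of_ereal p))"

definition feasible_region :: "real ^ 'n ^ 'm \<Rightarrow> real ^ 'm \<Rightarrow> (real ^ 'n) set" where
  "feasible_region A b = {x. b \<le> A *v x}"

definition redundant_constraint :: "real ^ 'n ^ 'm \<Rightarrow> real ^ 'm \<Rightarrow> 'm \<Rightarrow> bool" where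
  "redundant_constraint A b i \<longleftrightarrow>
     {x. \<forall>j. j \<noteq> i \<longrightarrow> b $ j \<le> row j A \<bullet> x} = feasible_region A b"

definition forward_optimal :: "real ^ 'n ^ 'm \<Rightarrow> real ^ 'm \<Rightarrow> real ^ 'n \<Rightarrow> (real ^ 'n) set" where
  "forward_optimal A b c = {x. is_arg_min (\<lambda>x. c \<bullet> x) (\<lambda>x. x \<in> feasible_region A b) x}"

definition conic_combinations :: "'i set \<Rightarrow> ('i \<Rightarrow> real ^ 'n) \<Rightarrow> (real ^ 'n) set" where
  "conic_combinations I a = {(\<Sum>i\<in>I. y i *\<^sub>R a i) | y. \<forall>i\<in>I. 0 \<le> y i}"

definition QIO_feasible ::
  "real ^ 'n ^ 'm \<Rightarrow> real ^ 'm \<Rightarrow> ereal \<Rightarrow> ereal \<Rightarrow> ('k::finite \<Rightarrow> real ^ 'n) \<Rightarrow> real \<Rightarrow> real \<Rightarrow>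
   real ^ 'n \<Rightarrow> ('k \<Rightarrow> real ^ 'n) \<Rightarrow> real ^ 'm \<Rightarrow> 'k set \<Rightarrow> bool" where
  "QIO_feasible A b l p X \<tau> \<theta> c \<epsilon> y S \<longleftrightarrow>
     transpose A *v y = c \<and> 0 \<le> y \<and>
     (\<forall>k\<in>S. b \<le> A *v (X k - \<epsilon> k) \<and> c \<bullet> (X k - \<epsilon> k) = b \<bullet> y \<and> lp_norm l (\<epsilon> k) \<le> \<tau>) \<and>
     real (card S) \<ge> \<theta> * real CARD('k) \<and>
     lp_norm p c = 1"

definition inverse_feasible ::
  "real ^ 'n ^ 'm \<Rightarrow> real ^ 'm \<Rightarrow> ereal \<Rightarrow> ereal \<Rightarrow> real \<Rightarrow> real \<Rightarrow> ('k::finite \<Rightarrow> real ^ 'n) \<Rightarrow>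
   (real ^ 'n) set" where
  "inverse_feasible A b l p \<tau> \<theta> X = {c. \<exists>\<epsilon> y S. QIO_feasible A b l p X \<tau> \<theta> c \<epsilon> y S}"

definition MIP_feasible ::
  "real ^ 'n ^ 'm \<Rightarrow> real ^ 'm \<Rightarrow> ereal \<Rightarrow> ('k::finite \<Rightarrow> real ^ 'n) \<Rightarrow> real \<Rightarrow> real \<Rightarrow> real \<Rightarrow> real \<Rightarrow>
   real ^ 'm \<Rightarrow> real ^ 'k \<Rightarrow> ('k \<Rightarrow> real ^ 'n) \<Rightarrow> bool" where
  "MIP_feasible A b l X \<tau> \<theta> M1 M2 v u \<epsilon> \<longleftrightarrow>
     (\<forall>i. v $ i \<in> {0, 1}) \<and> (\<forall>k. u $ k \<in> {0, 1}) \<and>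
     (\<forall>i k. b $ i \<le> row i A \<bullet> (X k - \<epsilon> k) \<and>
            row i A \<bullet> (X k - \<epsilon> k) \<le> b $ i + M1 * (1 - v $ i)) \<and>
     (\<forall>k. lp_norm l (\<epsilon> k) \<le> \<tau> + M2 * (1 - u $ k)) \<and>
     (\<Sum>k\<in>UNIV. u $ k) \<ge> \<theta> * real CARD('k)"

lemma conic_combinations_eq_hull:
  assumes "finite I"
  shows "conic_combinations I a = convex_cone hull (a ` I)"
proof
  show "conic_combinations I a \<subseteq> convex_cone hull (a ` I)"
  proof
    fix c assume "c \<in> conic_combinations I a"
    then obtain y where y: "\<forall>i\<in>I. 0 \<le> y i" and c: "c = (\<Sum>i\<in>I. y i *\<^sub>R a i)"
      unfolding conic_combinations_def by blast
    have "(\<Sum>i\<in>J. y i *\<^sub>R a i) \<in> convex_cone hull (a ` I)" if "finite J" "J \<subseteq> I" for J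
      using that
    proof (induction J rule: finite_induct)
      case empty
      then show ?case by (simp add: convex_cone_hull_contains_0)
    next
      case (insert i J)
      then show ?case
        using y by (simp add: convex_cone_hull_add convex_cone_hull_mul hull_inc)
    qed
    then show "c \<in> convex_cone hull (a ` I)" using assms c by blast
  qed
  have add: "x + z \<in> conic_combinations I a"
    if "x \<in> conic_combinations I a" "z \<in> conic_combinations I a" for x z
  proof -
    from that obtain y w where "\<forall>i\<in>I. 0 \<le> y i" "x = (\<Sum>i\<in>I. y i *\<^sub>R a i)"
      "\<forall>i\<in>I. 0 \<le> w i" "z = (\<Sum>i\<in>I. w i *\<^sub>R a i)"
      unfolding conic_combinations_def by blast
    then show ?thesis unfolding conic_combinations_def
      by (auto intro!: exI[of _ "\<lambda>i. y i + w i"] simp: scaleR_left_distrib sum.distrib)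
  qed
  have mul: "t *\<^sub>R x \<in> conic_combinations I a"
    if "x \<in> conic_combinations I a" "0 \<le> t" for x t
  proof -
    from that obtain y where "\<forall>i\<in>I. 0 \<le> y i" "x = (\<Sum>i\<in>I. y i *\<^sub>R a i)"
      unfolding conic_combinations_def by blast
    with \<open>0 \<le> t\<close> show ?thesis unfolding conic_combinations_def
      by (auto intro!: exI[of _ "\<lambda>i. t * y i"] simp: scaleR_sum_right)
  qed
  have ne: "0 \<in> conic_combinations I a"
    unfolding conic_combinations_def by (auto intro!: exI[of _ "\<lambda>_. 0"])
  have inc: "a ` I \<subseteq> conic_combinations I a"
  proof
    fix c assume "c \<in> a ` I"
    then obtain j where "j \<in> I" "c = a j" by blast
    have "(\<Sum>i\<in>I. (if i = j then 1 else 0) *\<^sub>R a i) = (\<Sum>i\<in>I. if i = j then a i else 0)"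
      by (rule sum.cong) auto
    then have "c = (\<Sum>i\<in>I. (if i = j then 1 else 0) *\<^sub>R a i)"
      using \<open>j \<in> I\<close> \<open>c = a j\<close> assms by simp
    then show "c \<in> conic_combinations I a"
      unfolding conic_combinations_def by (auto intro!: exI[of _ "\<lambda>i. if i = j then 1 else 0"])
  qed
  have "convex_cone (conic_combinations I a)"
    using add mul ne unfolding convex_cone_def convex_def conic_def by blast
  with inc show "convex_cone hull (a ` I) \<subseteq> conic_combinations I a"
    by (rule hull_minimal)
qed

lemma continuous_on_lp_norm:
  fixes f :: "'a::topological_space \<Rightarrow> real ^ 'n"
  assumes "1 \<le> p" and f: "continuous_on S f"
  shows "continuous_on S (\<lambda>x. lp_norm p (f x))"
proof (cases "p = \<infinity>")
  case True
  then show ?thesis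
    using f by (simp add: lp_norm_def continuous_on_def tendsto_infnorm)
next
  case False
  with assms(1) have "1 \<le> real_of_ereal p" by (cases p) auto
  with False show ?thesis
    unfolding lp_norm_def
    by (simp, intro continuous_on_powr' continuous_intros f) (auto simp: sum_nonneg)
qed

text \<open>
  The maximum over the optimal set is written as a supremum over the reals; the next two lemmas
  show that under the standing assumptions it is attained.
\<close>

lemma forward_optimal_compact_nonempty:
  assumes "bounded (feasible_region A b)" "feasible_region A b \<noteq> {}"
  shows "compact (forward_optimal A b c)" "forward_optimal A b c \<noteq> {}"
proof -
  have eq: "feasible_region A b = (\<Inter>i. {x. b $ i \<le> row i A \<bullet> x})"
    by (auto simp: feasible_region_def less_eq_vec_def matrix_mult_dot row_def)
  have "closed (feasible_region A b)"
    unfolding eq by (intro closed_INT ballI closed_Collect_le continuous_intros)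
  then have cpt: "compact (feasible_region A b)"
    using assms(1) by (simp add: compact_eq_bounded_closed)
  have "continuous_on (feasible_region A b) (\<lambda>x. c \<bullet> x)" by (intro continuous_intros)
  from continuous_attains_inf[OF cpt assms(2) this]
  obtain x0 where x0: "x0 \<in> feasible_region A b" "\<forall>y\<in>feasible_region A b. c \<bullet> x0 \<le> c \<bullet> y"
    by blast
  then show "forward_optimal A b c \<noteq> {}"
    by (auto simp: forward_optimal_def is_arg_min_linorder)
  have "forward_optimal A b c = feasible_region A b \<inter> {x. c \<bullet> x \<le> c \<bullet> x0}"
    using x0 by (force simp: forward_optimal_def is_arg_min_linorder)
  then show "compact (forward_optimal A b c)"
    using cpt by (simp add: compact_Int_closed closed_halfspace_le)
qed

lemma max_loss_attained:
  assumes "bounded (feasible_region A b)" "feasible_region A b \<noteq> {}" "1 \<le> l"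
  shows "\<exists>x\<in>forward_optimal A b c.
           (SUP z\<in>forward_optimal A b c. lp_norm l (w - z)) = lp_norm l (w - x) \<and>
           (\<forall>z\<in>forward_optimal A b c. lp_norm l (w - z) \<le> lp_norm l (w - x))"
proof -
  note cn = forward_optimal_compact_nonempty[OF assms(1,2), of c]
  have "continuous_on (forward_optimal A b c) (\<lambda>z. lp_norm l (w - z))"
    by (intro continuous_on_lp_norm assms(3) continuous_intros)
  from continuous_attains_sup[OF cn this]
  obtain x where x: "x \<in> forward_optimal A b c"
    "\<forall>z\<in>forward_optimal A b c. lp_norm l (w - z) \<le> lp_norm l (w - x)"
    by blast
  then have "(SUP z\<in>forward_optimal A b c. lp_norm l (w - z)) = lp_norm l (w - x)"
    by (intro cSup_eq_maximum) auto
  with x show ?thesis by blast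
qed

end

theory Submission
  imports Defs
begin

text \<open>Both parts reduce to the inclusion \<open>C_tilde\<close> \<subseteq>
  \<open>C_bar\<close>. Since the vectors are binary, \<open>v_bar\<close> \<ge>
  \<open>v_tilde\<close> says that every row selected by \<open>v_tilde\<close> is also selected by
  \<open>v_bar\<close>, and more generators span a larger cone
  (\<open>conic_combinations_mono\<close>). For forward stability, a cost vector of the smaller cone
  is its own counterpart in the larger one. For inverse stability, a dataset whose inverse-feasible
  set misses the larger cone also misses the smaller one, so the infimum for \<open>C_bar\<close>
  ranges over fewer datasets and cannot be lower.\<close>

lemma conic_combinations_mono:
  fixes a :: "'i \<Rightarrow> real ^ 'n"
  assumes "finite J" "I \<subseteq> J"
  shows "conic_combinations I a \<subseteq> conic_combinations J a"
  \<comment> \<open>Viewing both cones as hulls turns the claim into monotonicity of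
    \<open>hull\<close>, with no need to pad coefficients by zero on the extra indices.\<close>
  using assms conic_combinations_eq_hull[of _ a] finite_subset[OF assms(2,1)]
  by (simp add: hull_mono image_mono)

theorem proposition5:
  fixes A :: "real ^ 'n ^ 'm" and b :: "real ^ 'm"
    and l p :: ereal and \<tau> \<theta> M1 M2 :: real
    and X :: "'k::finite \<Rightarrow> real ^ 'n"
    and d :: "('k \<Rightarrow> real ^ 'n) \<Rightarrow> ('k \<Rightarrow> real ^ 'n) \<Rightarrow> real"
    and v_bar v_tilde :: "real ^ 'm" and u :: "real ^ 'k"
    and \<epsilon>_bar \<epsilon>_tilde :: "'k \<Rightarrow> real ^ 'n"
    and C_bar C_tilde :: "(real ^ 'n) set"
  assumes bounded: "bounded (feasible_region A b)"
    and full_dim: "aff_dim (feasible_region A b) = int CARD('n)"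
    and irredundant: "\<And>i. \<not> redundant_constraint A b i"
    and l: "1 \<le> l" and p: "1 \<le> p"
    and rows: "\<And>i. lp_norm p (row i A) = 1"
    and \<tau>: "0 \<le> \<tau>" and \<theta>: "0 \<le> \<theta>" "\<theta> \<le> 1"
    and d: "Metric_space UNIV d"
    and M1: "\<And>i x. x \<in> feasible_region A b \<Longrightarrow> row i A \<bullet> x - b $ i \<le> M1"
    and M2: "\<And>k x. x \<in> feasible_region A b \<Longrightarrow> lp_norm l (X k - x) \<le> M2"
    and feas_bar: "MIP_feasible A b l X \<tau> \<theta> M1 M2 v_bar u \<epsilon>_bar"
    and feas_tilde: "MIP_feasible A b l X \<tau> \<theta> M1 M2 v_tilde u \<epsilon>_tilde"
    and distinct: "(v_bar, u, \<epsilon>_bar) \<noteq> (v_tilde, u, \<epsilon>_tilde)"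
    and C_bar: "C_bar = conic_combinations {i. v_bar $ i = 1} (\<lambda>i. row i A)"
    and C_tilde: "C_tilde = conic_combinations {i. v_tilde $ i = 1} (\<lambda>i. row i A)"
    and v_ge: "v_bar \<ge> v_tilde"
  shows "(\<forall>c_tilde\<in>C_tilde. \<exists>c_bar\<in>C_bar. \<forall>k.
            (SUP x\<in>forward_optimal A b c_bar. lp_norm l (X k - x))
              \<le> (SUP x\<in>forward_optimal A b c_tilde. lp_norm l (X k - x))) \<and>
         (INF D\<in>{D. C_bar \<inter> inverse_feasible A b l p \<tau> \<theta> D = {}}. ereal (d X D))
           \<ge> (INF D\<in>{D. C_tilde \<inter> inverse_feasible A b l p \<tau> \<theta> D = {}}. ereal (d X D))"
proof -
  \<comment> \<open>Binarity is essential here: an entry of \<open>v_bar\<close> that is at least 1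
    must equal 1.\<close>
  have "v_bar $ i = 1" if "v_tilde $ i = 1" for i
  proof -
    have "v_bar $ i \<in> {0, 1}"
      using feas_bar by (simp add: MIP_feasible_def)
    moreover have "v_tilde $ i \<le> v_bar $ i"
      using v_ge by (simp add: less_eq_vec_def)
    ultimately show ?thesis
      using that by auto
  qed
  then have sub: "C_tilde \<subseteq> C_bar"
    unfolding C_bar C_tilde by (intro conic_combinations_mono) auto
  then have "{D. C_bar \<inter> inverse_feasible A b l p \<tau> \<theta> D = {}}
      \<subseteq> {D. C_tilde \<inter> inverse_feasible A b l p \<tau> \<theta> D = {}}"
    by blast
  \<comment> \<open>In \<open>ereal\<close> the infimum over the empty set is \<infinity>, so the
    case where no dataset misses \<open>C_bar\<close> needs no separate treatment.\<close>
  then have "(INF D\<in>{D. C_tilde \<inter> inverse_feasible A b l p \<tau> \<theta> D = {}}. ereal (d X D))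
      \<le> (INF D\<in>{D. C_bar \<inter> inverse_feasible A b l p \<tau> \<theta> D = {}}. ereal (d X D))"
    by (rule INF_superset_mono) simp
  \<comment> \<open>The witness for \<open>c_bar\<close> is \<open>c_tilde\<close> itself, which
    makes the two suprema identical for every \<open>k\<close>.\<close>
  with sub show ?thesis
    by blast
qed

end
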